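(* Let $\gamma:J\to S$ be a smooth regular curve on a surface $S\subset\mathbb{R}^3$ and let $\{e,h,N\}$ be its Darboux frame field. Suppose that the normal curvature function $\kappa_n$ of $\gamma$ on $S$ never vanishes. Then there exists a unique developable surface which contains $\gamma$ and which has everywhere the same tangent plane as $S$ along $\gamma$. It is parametrized by $$r(t,u)=\gamma(t)+u\,\frac{\hat\omega_t}{\|\hat\omega_t\|},\qquad u\in[-w_-(t),w_+(t)],\ t\in J,$$ where $$\hat\omega_t=\kappa_n(t)\,h(t)-\tau_g(t)\,e(t),\qquad \|\hat\omega_t\|=\sqrt{\kappa_n^2(t)+\tau_g^2(t)} .$$
   Context: $J=[0,\alpha]$. The Darboux frame field of $\gamma$ is $\{e,h,N\}$, where $N(t)$ is a (smoothly chosen) unit normal vector to $S$ at $\gamma(t)$, $e(t)=\gamma'(t)/\|\gamma'(t)\|$ and $h(t)=N(t)\times e(t)$. The geodesic curvature $\kappa_g$, normal curvature $\kappa_n$ and geodesic torsion $\tau_g$ are defined by $e'=\|\gamma'\|(\kappa_g h+\kappa_n N)$, $h'=\|\gamma'\|(-\kappa_g e+\tau_g N)$, $N'=\|\gamma'\|(-\kappa_n e-\tau_g h)$. A parametrized ruled surface based on the center curve $\gamma$ is a map $r(t,u)=\gamma(t)+u\,\beta(t)$, $t\in J$, $u\in[-w_-(t),w_+(t)]$, where $\beta$ is a smooth unit vector field along $\gamma$ and $w_-,w_+$ are positive functions on $J$; it is always assumed to be regular (the partial derivatives $r_t,r_u$ are linearly independent everywhere, so the width functions are taken small enough for this; in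 particular $\beta(t)\neq\pm e(t)$). "Developable surface containing $\gamma$" means such a regular ruled surface with zero Gaussian curvature everywhere, equivalently with $\beta'\cdot(\beta\times e)=0$. Having the same tangent plane as $S$ along $\gamma$ means $\beta\cdot N=0$. Uniqueness is uniqueness of the ruling field $\beta$ modulo sign, i.e. uniqueness of the surface up to the choice of the width functions $w_\pm$ and the sign of the parameter $u$. *)

theory Defs
  imports "HOL-Analysis.Analysis"
begin

section \<open>Smoothness\<close>

text \<open>Intended for domains on which derivatives are unique: open sets, where this is the usual
  notion of \<open>C\<^sup>k\<close>, and nondegenerate compact intervals, where derivatives at the end points
  are one-sided.\<close>

fun Ck_on :: "nat \<Rightarrow> 'a::real_normed_vector set \<Rightarrow> ('a \<Rightarrow> 'b::real_normed_vector) \<Rightarrow> bool" where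
  "Ck_on 0 X f \<longleftrightarrow> continuous_on X f"
| "Ck_on (Suc k) X f \<longleftrightarrow>
     (\<forall>x\<in>X. f differentiable (at x within X)) \<and>
     (\<forall>v. Ck_on k X (\<lambda>x. frechet_derivative f (at x within X) v))"

definition smooth_on :: "'a::real_normed_vector set \<Rightarrow> ('a \<Rightarrow> 'b::real_normed_vector) \<Rightarrow> bool" where
  "smooth_on X f \<longleftrightarrow> (\<forall>k. Ck_on k X f)"


section \<open>Regular surfaces\<close>

definition local_parametrization ::
    "(real^3) set \<Rightarrow> (real^2) set \<Rightarrow> (real^2 \<Rightarrow> real^3) \<Rightarrow> bool" where
  "local_parametrization S U x \<longleftrightarrow>
     open U \<and> smooth_on U x \<and> openin (top_of_set S) (x ` U) \<and>
     (\<exists>y. homeomorphism U (x ` U) x y) \<and>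
     (\<forall>q\<in>U. inj (frechet_derivative x (at q)))"

definition regular_surface :: "(real^3) set \<Rightarrow> bool" where
  "regular_surface S \<longleftrightarrow> (\<forall>p\<in>S. \<exists>U x. local_parametrization S U x \<and> p \<in> x ` U)"

text \<open>The tangent plane consists of the velocities at \<open>p\<close> of smooth curves in \<open>S\<close> through \<open>p\<close>.\<close>

definition tangent_plane :: "(real^3) set \<Rightarrow> real^3 \<Rightarrow> (real^3) set" where
  "tangent_plane S p =
     {v. \<exists>\<epsilon>>0. \<exists>c. smooth_on {-\<epsilon><..<\<epsilon>} c \<and> c ` {-\<epsilon><..<\<epsilon>} \<subseteq> S \<and>
         c 0 = p \<and> (c has_vector_derivative v) (at (0::real))}"


section \<open>Curves on surfaces and the Darboux frame\<close>

text \<open>The parameter interval \<open>J\<close> is explicit everywhere, since derivatives at its end points are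
  taken within \<open>J\<close>.\<close>

abbreviation deriv_on :: "real set \<Rightarrow> (real \<Rightarrow> 'a::real_normed_vector) \<Rightarrow> real \<Rightarrow> 'a" where
  "deriv_on J f t \<equiv> vector_derivative f (at t within J)"

definition regular_curve_on :: "(real^3) set \<Rightarrow> real set \<Rightarrow> (real \<Rightarrow> real^3) \<Rightarrow> bool" where
  "regular_curve_on S J \<gamma> \<longleftrightarrow>
     smooth_on J \<gamma> \<and> \<gamma> ` J \<subseteq> S \<and> (\<forall>t\<in>J. deriv_on J \<gamma> t \<noteq> 0)"

definition unit_normal_along ::
    "(real^3) set \<Rightarrow> real set \<Rightarrow> (real \<Rightarrow> real^3) \<Rightarrow> (real \<Rightarrow> real^3) \<Rightarrow> bool" where
  "unit_normal_along S J \<gamma> N \<longleftrightarrow>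
     smooth_on J N \<and>
     (\<forall>t\<in>J. norm (N t) = 1 \<and> (\<forall>v\<in>tangent_plane S (\<gamma> t). orthogonal (N t) v))"

definition darboux_e :: "real set \<Rightarrow> (real \<Rightarrow> real^3) \<Rightarrow> real \<Rightarrow> real^3" where
  "darboux_e J \<gamma> t = deriv_on J \<gamma> t /\<^sub>R norm (deriv_on J \<gamma> t)"

definition darboux_h :: "real set \<Rightarrow> (real \<Rightarrow> real^3) \<Rightarrow> (real \<Rightarrow> real^3) \<Rightarrow> real \<Rightarrow> real^3" where
  "darboux_h J \<gamma> N t = cross3 (N t) (darboux_e J \<gamma> t)"

text \<open>The geodesic curvature \<open>\<kappa>g\<close>, normal curvature \<open>\<kappa>n\<close> and geodesic torsion \<open>\<tau>g\<close> are the
  functions on \<open>J\<close> determined by the Darboux equations.\<close>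

definition darboux_curvatures ::
    "real set \<Rightarrow> (real \<Rightarrow> real^3) \<Rightarrow> (real \<Rightarrow> real^3) \<Rightarrow>
     (real \<Rightarrow> real) \<Rightarrow> (real \<Rightarrow> real) \<Rightarrow> (real \<Rightarrow> real) \<Rightarrow> bool" where
  "darboux_curvatures J \<gamma> N \<kappa>g \<kappa>n \<tau>g \<longleftrightarrow>
     (\<forall>t\<in>J. let v = norm (deriv_on J \<gamma> t); e = darboux_e J \<gamma>; h = darboux_h J \<gamma> N in
        deriv_on J e t = v *\<^sub>R (\<kappa>g t *\<^sub>R h t + \<kappa>n t *\<^sub>R N t) \<and>
        deriv_on J h t = v *\<^sub>R (- \<kappa>g t *\<^sub>R e t + \<tau>g t *\<^sub>R N t) \<and>
        deriv_on J N t = v *\<^sub>R (- \<kappa>n t *\<^sub>R e t - \<tau>g t *\<^sub>R h t))"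


section \<open>Parametrized surfaces\<close>

text \<open>A parametrized surface is a map \<open>r t u\<close>, with \<open>t\<close> in \<open>J\<close> and \<open>u\<close> real.  Ruled surfaces
  are used only for \<open>u\<close> in \<open>[-w\<^sub>-(t), w\<^sub>+(t)]\<close>, but their formula makes sense for all \<open>u\<close>; hence
  the partial derivatives in \<open>u\<close> are two-sided.\<close>

definition partial_t :: "real set \<Rightarrow> (real \<Rightarrow> real \<Rightarrow> real^3) \<Rightarrow> real \<Rightarrow> real \<Rightarrow> real^3" where
  "partial_t J r t u = deriv_on J (\<lambda>s. r s u) t"

definition partial_u :: "(real \<Rightarrow> real \<Rightarrow> real^3) \<Rightarrow> real \<Rightarrow> real \<Rightarrow> real^3" where
  "partial_u r t u = vector_derivative (r t) (at u)"

text \<open>The inequality is needed because \<open>independent\<close> concerns the set of the two vectors.\<close>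

definition regular_at :: "real set \<Rightarrow> (real \<Rightarrow> real \<Rightarrow> real^3) \<Rightarrow> real \<Rightarrow> real \<Rightarrow> bool" where
  "regular_at J r t u \<longleftrightarrow>
     partial_t J r t u \<noteq> partial_u r t u \<and> independent {partial_t J r t u, partial_u r t u}"

definition surface_normal :: "real set \<Rightarrow> (real \<Rightarrow> real \<Rightarrow> real^3) \<Rightarrow> real \<Rightarrow> real \<Rightarrow> real^3" where
  "surface_normal J r t u =
     (let c = cross3 (partial_t J r t u) (partial_u r t u) in c /\<^sub>R norm c)"

text \<open>\<open>E, F, G\<close> and \<open>L, M, N\<close> are the coefficients of the first and second fundamental forms.\<close>

definition gaussian_curvature :: "real set \<Rightarrow> (real \<Rightarrow> real \<Rightarrow> real^3) \<Rightarrow> real \<Rightarrow> real \<Rightarrow> real" where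
  "gaussian_curvature J r t u =
     (let rt = partial_t J r t u;
          ru = partial_u r t u;
          n = surface_normal J r t u;
          E = rt \<bullet> rt;
          F = rt \<bullet> ru;
          G = ru \<bullet> ru;
          L = partial_t J (partial_t J r) t u \<bullet> n;
          M = partial_u (partial_t J r) t u \<bullet> n;
          N = partial_u (partial_u r) t u \<bullet> n
      in (L * N - M\<^sup>2) / (E * G - F\<^sup>2))"


section \<open>Ruled and developable surfaces based on a curve\<close>

definition ruled :: "(real \<Rightarrow> real^3) \<Rightarrow> (real \<Rightarrow> real^3) \<Rightarrow> real \<Rightarrow> real \<Rightarrow> real^3" where
  "ruled \<gamma> \<beta> t u = \<gamma> t + u *\<^sub>R \<beta> t"

definition regular_ruled_surface ::
    "real set \<Rightarrow> (real \<Rightarrow> real^3) \<Rightarrow> (real \<Rightarrow> real^3) \<Rightarrow> (real \<Rightarrow> real) \<Rightarrow> (real \<Rightarrow> real) \<Rightarrow> bool" where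
  "regular_ruled_surface J \<gamma> \<beta> wm wp \<longleftrightarrow>
     smooth_on J \<beta> \<and> (\<forall>t\<in>J. norm (\<beta> t) = 1) \<and>
     (\<forall>t\<in>J. 0 < wm t \<and> 0 < wp t) \<and>
     (\<forall>t\<in>J. \<forall>u\<in>{- wm t..wp t}. regular_at J (ruled \<gamma> \<beta>) t u)"

definition developable_surface ::
    "real set \<Rightarrow> (real \<Rightarrow> real^3) \<Rightarrow> (real \<Rightarrow> real^3) \<Rightarrow> (real \<Rightarrow> real) \<Rightarrow> (real \<Rightarrow> real) \<Rightarrow> bool" where
  "developable_surface J \<gamma> \<beta> wm wp \<longleftrightarrow>
     regular_ruled_surface J \<gamma> \<beta> wm wp \<and>
     (\<forall>t\<in>J. \<forall>u\<in>{- wm t..wp t}. gaussian_curvature J (ruled \<gamma> \<beta>) t u = 0)"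

definition same_tangent_plane_along ::
    "(real^3) set \<Rightarrow> real set \<Rightarrow> (real \<Rightarrow> real^3) \<Rightarrow> (real \<Rightarrow> real^3) \<Rightarrow> bool" where
  "same_tangent_plane_along S J \<gamma> \<beta> \<longleftrightarrow>
     (\<forall>t\<in>J. span {partial_t J (ruled \<gamma> \<beta>) t 0, partial_u (ruled \<gamma> \<beta>) t 0}
              = tangent_plane S (\<gamma> t))"

definition omega_hat ::
    "real set \<Rightarrow> (real \<Rightarrow> real^3) \<Rightarrow> (real \<Rightarrow> real^3) \<Rightarrow>
     (real \<Rightarrow> real) \<Rightarrow> (real \<Rightarrow> real) \<Rightarrow> real \<Rightarrow> real^3" where
  "omega_hat J \<gamma> N \<kappa>n \<tau>g t = \<kappa>n t *\<^sub>R darboux_h J \<gamma> N t - \<tau>g t *\<^sub>R darboux_e J \<gamma> t"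

definition developable_ruling ::
    "real set \<Rightarrow> (real \<Rightarrow> real^3) \<Rightarrow> (real \<Rightarrow> real^3) \<Rightarrow>
     (real \<Rightarrow> real) \<Rightarrow> (real \<Rightarrow> real) \<Rightarrow> real \<Rightarrow> real^3" where
  "developable_ruling J \<gamma> N \<kappa>n \<tau>g t = omega_hat J \<gamma> N \<kappa>n \<tau>g t /\<^sub>R norm (omega_hat J \<gamma> N \<kappa>n \<tau>g t)"

end

theory Submission
  imports Defs
begin

text \<open>A ruled surface with ruling field \<open>\<beta>\<close> along \<open>\<gamma>\<close> has curvature zero exactly where
  \<open>\<beta>' \<bullet> (\<gamma>' \<times> \<beta>) = 0\<close>. If it shares the tangent planes of \<open>S\<close>, then \<open>\<gamma>' \<times> \<beta>\<close> is parallel to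
  \<open>N\<close> and the condition becomes \<open>\<beta>' \<bullet> N = 0\<close>, which is \<open>\<beta> \<bullet> N' = 0\<close> because \<open>\<beta> \<bullet> N = 0\<close>.
  So \<open>\<beta>\<close> is orthogonal to both \<open>N\<close> and \<open>N'\<close>, and \<open>\<omega>\<close> spans the line of such vectors. It is
  transversal to \<open>\<gamma>\<close> because \<open>\<kappa>n \<noteq> 0\<close>, and compactness of \<open>J\<close> gives a uniform width on which
  the surface is regular.\<close>

section \<open>Calculus of smooth functions on real sets\<close>

context
  fixes X :: "real set"
  assumes nontrivial: "\<And>t. t \<in> X \<Longrightarrow> at t within X \<noteq> bot"
begin

text \<open>A linear map on the reals is determined by its value at 1. Without isolated points the
  derivative within \<open>X\<close> is unique, so the Frechet derivatives in the recursion of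
  \<open>Ck_on\<close> can be traded for vector derivatives.\<close>

lemma frechet_derivative_real:
  assumes "t \<in> X" "f differentiable (at t within X)"
  shows "frechet_derivative f (at t within X) v = v *\<^sub>R deriv_on X f t"
proof -
  let ?F = "frechet_derivative f (at t within X)"
  have F: "(f has_derivative ?F) (at t within X)"
    using assms frechet_derivative_works by blast
  then interpret F: bounded_linear ?F by (rule has_derivative_bounded_linear)
  have eq: "?F w = w *\<^sub>R ?F 1" for w
    using F.scaleR[of w 1] by simp
  have "?F = (\<lambda>w. w *\<^sub>R ?F 1)"
    using eq by blast
  with F have "(f has_vector_derivative ?F 1) (at t within X)"
    unfolding has_vector_derivative_def by metis
  then have "deriv_on X f t = ?F 1"
    by (intro vector_derivative_within nontrivial assms)
  then show ?thesis using eq[of v] by simp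
qed

lemma deriv_on_eq:
  assumes "t \<in> X" "(f has_vector_derivative f') (at t within X)"
  shows "deriv_on X f t = f'"
  using assms by (intro vector_derivative_within nontrivial)

lemma frechet_derivative_real':
  assumes "t \<in> X" "(f has_vector_derivative f') (at t within X)"
  shows "frechet_derivative f (at t within X) v = v *\<^sub>R f'"
  using frechet_derivative_real[OF assms(1) differentiableI_vector[OF assms(2)], of v]
    deriv_on_eq[OF assms] by simp

text \<open>Explicit formulas for derivatives are valid only on \<open>X\<close>. A derivative
  within \<open>X\<close> at a point of \<open>X\<close> sees only values on \<open>X\<close>, so
  such formulas may be substituted at every order of the recursion.\<close>

lemma Ck_on_cong:
  assumes "Ck_on k X f" "\<And>t. t \<in> X \<Longrightarrow> f t = g t"
  shows "Ck_on k X g"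
  using assms
proof (induction k arbitrary: f g)
  case 0
  then show ?case using continuous_on_cong by force
next
  case (Suc k)
  have tr: "(g has_derivative D) (at t within X)" if "(f has_derivative D) (at t within X)" "t \<in> X" for t D
    using has_derivative_transform[OF that(2) _ that(1), of g] Suc.prems(2) by simp
  have D: "g differentiable (at t within X)" if "t \<in> X" for t
  proof -
    have "f differentiable (at t within X)" using Suc.prems(1) that by simp
    then show ?thesis unfolding differentiable_def using tr that by blast
  qed
  have eq: "frechet_derivative f (at t within X) v = frechet_derivative g (at t within X) v" if "t \<in> X" for t v
  proof -
    have f: "(f has_vector_derivative deriv_on X f t) (at t within X)"
      using Suc.prems(1) that vector_derivative_works by auto
    then have "(g has_vector_derivative deriv_on X f t) (at t within X)"
      unfolding has_vector_derivative_def using tr that by blast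
    then show ?thesis
      using f that by (simp add: frechet_derivative_real')
  qed
  have "Ck_on k X (\<lambda>t. frechet_derivative g (at t within X) v)" for v
    using Suc.prems(1) by (intro Suc.IH[OF _ eq]) auto
  then show ?case
    using D by simp
qed

lemma Ck_on_scaleR_const:
  assumes "Ck_on k X f"
  shows "Ck_on k X (\<lambda>t. c *\<^sub>R f t)"
  using assms
proof (induction k arbitrary: f)
  case 0
  then show ?case by (auto intro!: continuous_intros)
next
  case (Suc k)
  have *: "((\<lambda>t. c *\<^sub>R f t) has_vector_derivative c *\<^sub>R deriv_on X f t) (at t within X)" if "t \<in> X" for t
    using Suc.prems that vector_derivative_works
    by (intro bounded_linear.has_vector_derivative[OF bounded_linear_scaleR_right]) auto
  have fd: "frechet_derivative (\<lambda>t. c *\<^sub>R f t) (at t within X) v = c *\<^sub>R frechet_derivative f (at t within X) v"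
    if "t \<in> X" for t v
    using Suc.prems frechet_derivative_real'[OF that *[OF that]] that
    by (simp add: frechet_derivative_real)
  have "Ck_on k X (\<lambda>t. frechet_derivative (\<lambda>t. c *\<^sub>R f t) (at t within X) v)" for v
    by (rule Ck_on_cong[OF Suc.IH fd[symmetric]]) (use Suc.prems in simp)
  then show ?case using * by (auto intro: differentiableI_vector)
qed

text \<open>Together with \<open>Ck_on_SucD\<close>, this reduces the recursion over all directions
  to a single derivative function: every directional derivative is a constant multiple of
  it.\<close>

lemma Ck_on_SucI:
  assumes "\<And>t. t \<in> X \<Longrightarrow> (f has_vector_derivative f' t) (at t within X)" "Ck_on k X f'"
  shows "Ck_on (Suc k) X f"
proof -
  have "Ck_on k X (\<lambda>t. frechet_derivative f (at t within X) v)" for v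
    by (rule Ck_on_cong[OF Ck_on_scaleR_const[OF assms(2), of v]])
       (rule frechet_derivative_real'[OF _ assms(1), symmetric])
  then show ?thesis using assms(1) by (auto intro: differentiableI_vector)
qed

lemma Ck_on_SucD:
  assumes "Ck_on (Suc k) X f"
  shows "t \<in> X \<Longrightarrow> (f has_vector_derivative deriv_on X f t) (at t within X)"
    and "Ck_on k X (deriv_on X f)"
proof -
  show "(f has_vector_derivative deriv_on X f t) (at t within X)" if "t \<in> X" for t
    using assms that vector_derivative_works by auto
  have "Ck_on k X (\<lambda>t. frechet_derivative f (at t within X) 1)" using assms by simp
  then show "Ck_on k X (deriv_on X f)"
    by (rule Ck_on_cong) (use assms in \<open>simp add: frechet_derivative_real\<close>)
qed

lemma Ck_on_lower: "Ck_on (Suc k) X f \<Longrightarrow> Ck_on k X f"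
proof (induction k arbitrary: f)
  case 0
  then show ?case
    using differentiable_imp_continuous_within by (auto simp: continuous_on_eq_continuous_within)
next
  case (Suc k)
  show ?case by (rule Ck_on_SucI[OF Ck_on_SucD(1)[OF Suc.prems] Suc.IH[OF Ck_on_SucD(2)[OF Suc.prems]]])
qed

section \<open>Sums, products, reciprocals, roots and compositions\<close>

lemma Ck_on_add:
  assumes "Ck_on k X f" "Ck_on k X g"
  shows "Ck_on k X (\<lambda>t. f t + g t)"
  using assms
proof (induction k arbitrary: f g)
  case 0
  then show ?case by (auto intro!: continuous_intros)
next
  case (Suc k)
  show ?case
    by (rule Ck_on_SucI[OF has_vector_derivative_add Suc.IH])
       (use Suc.prems Ck_on_SucD in blast)+
qed

text \<open>In each term of the product rule one factor is undifferentiated; lowering its order by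
  one makes the induction hypothesis applicable. One statement serves scalar multiples, inner
  products and cross products.\<close>

lemma Ck_on_bilinear:
  assumes "bounded_bilinear B" "Ck_on k X f" "Ck_on k X g"
  shows "Ck_on k X (\<lambda>t. B (f t) (g t))"
  using assms(2,3)
proof (induction k arbitrary: f g)
  case 0
  then show ?case by (auto intro!: bounded_bilinear.continuous_on[OF assms(1)])
next
  case (Suc k)
  show ?case
    by (rule Ck_on_SucI[OF bounded_bilinear.has_vector_derivative[OF assms(1)] Ck_on_add[OF Suc.IH Suc.IH]])
       (use Suc.prems Ck_on_SucD Ck_on_lower in blast)+
qed

text \<open>The derivative \<open>- f' / f^2\<close> involves only \<open>f'\<close> and the
  reciprocal itself, which is available one order lower by induction.\<close>

lemma Ck_on_inverse:
  fixes f :: "real \<Rightarrow> real"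
  assumes "Ck_on k X f" "\<And>t. t \<in> X \<Longrightarrow> f t \<noteq> 0"
  shows "Ck_on k X (\<lambda>t. inverse (f t))"
  using assms(1)
proof (induction k)
  case 0
  then show ?case using assms(2) by (auto intro!: continuous_intros)
next
  case (Suc k)
  have d: "((\<lambda>t. inverse (f t)) has_vector_derivative
      (-1) *\<^sub>R (deriv_on X f t * (inverse (f t) * inverse (f t)))) (at t within X)" if "t \<in> X" for t
    using Ck_on_SucD(1)[OF Suc.prems that] assms(2)[OF that]
    unfolding has_real_derivative_iff_has_vector_derivative[symmetric]
    by (auto intro!: derivative_eq_intros simp: algebra_simps)
  note i = Suc.IH[OF Ck_on_lower[OF Suc.prems]]
  show ?case
    by (rule Ck_on_SucI[OF d Ck_on_scaleR_const[OF Ck_on_bilinear[OF bounded_bilinear_mult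
          Ck_on_SucD(2)[OF Suc.prems] Ck_on_bilinear[OF bounded_bilinear_mult i i]]]])
qed

lemma Ck_on_sqrt:
  fixes f :: "real \<Rightarrow> real"
  assumes "Ck_on k X f" "\<And>t. t \<in> X \<Longrightarrow> f t > 0"
  shows "Ck_on k X (\<lambda>t. sqrt (f t))"
  using assms(1)
proof (induction k)
  case 0
  then show ?case using assms(2) by (auto intro!: continuous_intros)
next
  case (Suc k)
  have d: "((\<lambda>t. sqrt (f t)) has_vector_derivative
      (1/2) *\<^sub>R (deriv_on X f t * inverse (sqrt (f t)))) (at t within X)" if "t \<in> X" for t
    using Ck_on_SucD(1)[OF Suc.prems that] assms(2)[OF that]
    unfolding has_real_derivative_iff_has_vector_derivative[symmetric]
    by (auto intro!: derivative_eq_intros simp: field_simps)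
  have i: "Ck_on k X (\<lambda>t. inverse (sqrt (f t)))"
    using assms(2) by (intro Ck_on_inverse Suc.IH Ck_on_lower[OF Suc.prems]) force
  show ?case
    by (rule Ck_on_SucI[OF d Ck_on_scaleR_const[OF Ck_on_bilinear[OF bounded_bilinear_mult
          Ck_on_SucD(2)[OF Suc.prems] i]]])
qed

text \<open>The norm is the square root of an inner product, which is positive where
  \<open>f\<close> does not vanish, so the preceding operations suffice.\<close>

lemma Ck_on_normalize:
  fixes f :: "real \<Rightarrow> 'a::real_inner"
  assumes "Ck_on k X f" "\<And>t. t \<in> X \<Longrightarrow> f t \<noteq> 0"
  shows "Ck_on k X (\<lambda>t. f t /\<^sub>R norm (f t))"
proof -
  have "Ck_on k X (\<lambda>t. inverse (sqrt (f t \<bullet> f t)) *\<^sub>R f t)"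
    using assms
    by (intro Ck_on_bilinear[OF bounded_bilinear_scaleR] Ck_on_inverse Ck_on_sqrt
        Ck_on_bilinear[OF bounded_bilinear_inner]) auto
  then show ?thesis by (simp add: norm_eq_sqrt_inner)
qed

text \<open>The derivative is the directional derivative of \<open>x\<close> in the fixed direction
  \<open>w\<close>, taken along the same line, so the induction runs over \<open>x\<close>. This
  supplies the smooth curves behind the tangent vectors of a surface.\<close>

lemma Ck_on_comp_line:
  assumes "Ck_on k U x" "\<And>s. s \<in> X \<Longrightarrow> q + s *\<^sub>R w \<in> U"
  shows "Ck_on k X (\<lambda>s. x (q + s *\<^sub>R w))"
  using assms(1)
proof (induction k arbitrary: x)
  case 0
  then show ?case using assms(2)
    by (auto intro!: continuous_intros continuous_on_compose2[of U x])
next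
  case (Suc k)
  let ?D = "\<lambda>p. frechet_derivative x (at p within U)"
  have "((\<lambda>s. x (q + s *\<^sub>R w)) has_vector_derivative ?D (q + s *\<^sub>R w) w) (at s within X)" if "s \<in> X" for s
  proof -
    have D: "(x has_derivative ?D (q + s *\<^sub>R w)) (at (q + s *\<^sub>R w) within U)"
      using Suc.prems assms(2)[OF that] frechet_derivative_works by auto
    have "((\<lambda>s. q + s *\<^sub>R w) has_derivative (\<lambda>h. h *\<^sub>R w)) (at s within X)"
      by (auto intro!: derivative_eq_intros)
    moreover have "(x has_derivative ?D (q + s *\<^sub>R w)) (at (q + s *\<^sub>R w) within (\<lambda>s. q + s *\<^sub>R w) ` X)"
      by (rule has_derivative_subset[OF D]) (use assms(2) in auto)
    ultimately have "(x \<circ> (\<lambda>s. q + s *\<^sub>R w) has_derivative ?D (q + s *\<^sub>R w) \<circ> (\<lambda>h. h *\<^sub>R w)) (at s within X)"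
      by (rule diff_chain_within)
    moreover have "?D (q + s *\<^sub>R w) (h *\<^sub>R w) = h *\<^sub>R ?D (q + s *\<^sub>R w) w" for h
      using D has_derivative_bounded_linear bounded_linear.linear linear_scale by blast
    ultimately show ?thesis by (simp add: has_vector_derivative_def o_def)
  qed
  moreover have "Ck_on k X (\<lambda>s. ?D (q + s *\<^sub>R w) w)"
    using Suc.prems by (intro Suc.IH) auto
  ultimately show ?case by (rule Ck_on_SucI)
qed


lemma inner_const_deriv:
  assumes "(f has_vector_derivative f') (at t within X)" "(g has_vector_derivative g') (at t within X)"
    and "\<And>s. s \<in> X \<Longrightarrow> f s \<bullet> g s = c" "t \<in> X"
  shows "f t \<bullet> g' + f' \<bullet> g t = 0"
proof -
  have "((\<lambda>s. f s \<bullet> g s) has_vector_derivative f t \<bullet> g' + f' \<bullet> g t) (at t within X)"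
    by (rule bounded_bilinear.has_vector_derivative[OF bounded_bilinear_inner assms(1,2)])
  moreover have "((\<lambda>s. f s \<bullet> g s) has_vector_derivative 0) (at t within X)"
    by (rule has_vector_derivative_transform[OF assms(4,3) has_vector_derivative_const])
  ultimately show ?thesis
    using vector_derivative_unique_within nontrivial assms(4) by blast
qed

lemma smooth_onD:
  assumes "smooth_on X f"
  shows "t \<in> X \<Longrightarrow> (f has_vector_derivative deriv_on X f t) (at t within X)"
    and "smooth_on X (deriv_on X f)"
proof -
  have Suc: "Ck_on (Suc k) X f" for k
    using assms unfolding smooth_on_def by blast
  show "(f has_vector_derivative deriv_on X f t) (at t within X)" if "t \<in> X"
    by (rule Ck_on_SucD(1)[OF Suc that])
  show "smooth_on X (deriv_on X f)"
    unfolding smooth_on_def by (rule allI, rule Ck_on_SucD(2)[OF Suc])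
qed

lemma smooth_on_bilinear:
  "bounded_bilinear B \<Longrightarrow> smooth_on X f \<Longrightarrow> smooth_on X g \<Longrightarrow> smooth_on X (\<lambda>t. B (f t) (g t))"
  unfolding smooth_on_def by (simp add: Ck_on_bilinear)

lemma smooth_on_normalize:
  fixes f :: "real \<Rightarrow> 'a::real_inner"
  shows "smooth_on X f \<Longrightarrow> (\<And>t. t \<in> X \<Longrightarrow> f t \<noteq> 0) \<Longrightarrow> smooth_on X (\<lambda>t. f t /\<^sub>R norm (f t))"
  unfolding smooth_on_def by (simp add: Ck_on_normalize)

end

lemma smooth_on_imp_continuous_on: "smooth_on X f \<Longrightarrow> continuous_on X f"
  unfolding smooth_on_def Ck_on.simps(1)[symmetric] by blast

section \<open>Planes in space and tangent planes\<close>

lemma bounded_bilinear_cross3: "bounded_bilinear cross3"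
  using bilinear_cross bilinear_conv_bounded_bilinear by blast

lemma triple_product_cycle: "x \<bullet> cross3 y z = z \<bullet> cross3 x y"
  by (simp add: cross3_simps)

text \<open>Turns regularity into nonvanishing of the cross product of the partial derivatives,
  which for a ruled surface is affine in \<open>u\<close>.\<close>

lemma independent_iff_cross3:
  "a \<noteq> b \<and> independent {a, b} \<longleftrightarrow> cross3 a b \<noteq> 0"
proof (cases "a = b")
  case False
  then have "independent {a, b} \<longleftrightarrow> b \<noteq> 0 \<and> (\<forall>k. a \<noteq> k *\<^sub>R b)"
    by (auto simp: independent_insert span_singleton)
  moreover have "collinear {0, a, b} \<longleftrightarrow> b = 0 \<or> (\<exists>k. a = k *\<^sub>R b)"
    unfolding insert_commute[of a b] collinear_lemma by (auto intro: exI[of _ 0])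
  ultimately show ?thesis using False by (auto simp: cross_eq_0)
qed simp

lemma span_eq_plane:
  fixes n :: "real^3"
  assumes "cross3 a b \<noteq> 0" "n \<noteq> 0" "n \<bullet> a = 0" "n \<bullet> b = 0"
  shows "span {a, b} = {v. n \<bullet> v = 0}"
proof (rule subspace_dim_equal)
  show "span {a, b} \<subseteq> {v. n \<bullet> v = 0}"
    using assms by (intro span_minimal subspace_hyperplane) auto
  have "independent {a, b}" "a \<noteq> b" using assms(1) independent_iff_cross3 by auto
  then have "dim (span {a, b}) = 2" by (simp add: dim_eq_card_independent)
  then show "dim {v. n \<bullet> v = 0} \<le> dim (span {a, b})"
    using dim_hyperplane[OF assms(2)] by simp
qed (auto simp: subspace_hyperplane)

text \<open>Both \<open>n\<close> and \<open>cross3 a b\<close> are normals of the plane spanned by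
  \<open>a\<close> and \<open>b\<close>. Thus the surface normal can replace the cross product in
  the curvature condition.\<close>

lemma inner_cross3_eq_0_iff:
  fixes n :: "real^3"
  assumes "cross3 a b \<noteq> 0" "n \<noteq> 0" "n \<bullet> a = 0" "n \<bullet> b = 0"
  shows "w \<bullet> cross3 a b = 0 \<longleftrightarrow> n \<bullet> w = 0"
proof -
  have "{v. n \<bullet> v = 0} = {v. cross3 a b \<bullet> v = 0}"
    by (rule trans[OF span_eq_plane[OF assms, symmetric] span_eq_plane[OF assms(1,1) dot_cross_self(4,3)]])
  then have "n \<bullet> w = 0 \<longleftrightarrow> cross3 a b \<bullet> w = 0"
    unfolding set_eq_iff mem_Collect_eq by (rule spec)
  then show ?thesis by (simp only: inner_commute[of w])
qed

text \<open>A set of velocities is not a subspace by definition. It is squeezed between the range of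
  the derivative of a chart and the plane orthogonal to \<open>n\<close>; both have dimension two,
  so all three coincide.\<close>

lemma tangent_plane_eq_hyperplane:
  assumes "regular_surface S" "p \<in> S" "n \<noteq> 0" "\<And>v. v \<in> tangent_plane S p \<Longrightarrow> n \<bullet> v = 0"
  shows "tangent_plane S p = {v. n \<bullet> v = 0}"
proof -
  obtain U x where "local_parametrization S U x" "p \<in> x ` U"
    using assms(1,2) unfolding regular_surface_def by blast
  then obtain q where U: "local_parametrization S U x" "q \<in> U" "p = x q"
    by blast
  have op: "open U" and sm: "smooth_on U x" and S: "x ` U \<subseteq> S"
    and inj: "inj (frechet_derivative x (at q))"
    using U(1,2) by (auto simp: local_parametrization_def dest: openin_imp_subset)
  let ?F = "frechet_derivative x (at q)"
  have "Ck_on (Suc 0) U x" using sm unfolding smooth_on_def by blast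
  then have "x differentiable (at q)"
    unfolding Ck_on.simps at_within_open[OF U(2) op, symmetric] using U(2) by blast
  then have F: "(x has_derivative ?F) (at q)" by (simp add: frechet_derivative_works)
  then have lin: "linear ?F" using has_derivative_linear by blast
  \<comment> \<open>The chart maps the line through \<open>q\<close> in direction \<open>w\<close>
    to a curve in \<open>S\<close> with velocity \<open>?F w\<close>; \<open>\<epsilon>\<close> is
    chosen so that the segment stays in \<open>U\<close>.\<close>
  have "?F w \<in> tangent_plane S p" for w
  proof -
    have "isCont (\<lambda>s. q + s *\<^sub>R w) (0::real)" by (intro continuous_intros)
    then have "\<forall>\<^sub>F s in at (0::real). q + s *\<^sub>R w \<in> U"
      using op U(2) unfolding isCont_def by (intro topological_tendstoD) auto
    then obtain \<epsilon> where \<epsilon>: "\<epsilon> > 0" "\<And>s. s \<noteq> 0 \<Longrightarrow> dist s 0 < \<epsilon> \<Longrightarrow> q + s *\<^sub>R w \<in> U"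
      unfolding eventually_at by blast
    let ?I = "{-\<epsilon><..<\<epsilon>}"
    have in_U: "q + s *\<^sub>R w \<in> U" if "s \<in> ?I" for s
      using \<epsilon>(2)[of s] that U(2) by (cases "s = 0") (auto simp: dist_real_def)
    let ?c = "\<lambda>s. x (q + s *\<^sub>R w)"
    have nt: "at t within ?I \<noteq> bot" if "t \<in> ?I" for t
      using at_within_open[OF that open_greaterThanLessThan] by simp
    have Ck: "Ck_on k U x" for k using sm unfolding smooth_on_def by blast
    have "smooth_on ?I ?c"
      unfolding smooth_on_def by (rule allI, rule Ck_on_comp_line[OF nt Ck in_U])
    moreover have "(?c has_vector_derivative ?F w) (at 0)"
    proof -
      have "((\<lambda>s. q + s *\<^sub>R w) has_derivative (\<lambda>h. h *\<^sub>R w)) (at 0)"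
        by (auto intro!: derivative_eq_intros)
      then have "(x \<circ> (\<lambda>s. q + s *\<^sub>R w) has_derivative ?F \<circ> (\<lambda>h. h *\<^sub>R w)) (at 0)"
        using F by (intro diff_chain_at) auto
      then show ?thesis
        using linear_scale[OF lin] by (simp add: has_vector_derivative_def o_def)
    qed
    moreover have "?c ` ?I \<subseteq> S" using in_U S by blast
    moreover have "?c 0 = p" using U(3) by simp
    ultimately show ?thesis
      unfolding tangent_plane_def using \<epsilon>(1) by (intro CollectI exI[of _ \<epsilon>] exI[of _ ?c] conjI)
  qed
  then have sub: "range ?F \<subseteq> tangent_plane S p" by blast
  have "range ?F = {v. n \<bullet> v = 0}"
  proof (rule subspace_dim_equal)
    show "subspace (range ?F)" using lin by (simp add: linear_subspace_image)
    show "range ?F \<subseteq> {v. n \<bullet> v = 0}" using sub assms(4) by blast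
    have "dim (range ?F) = 2" using dim_image_eq[OF lin] inj by (simp add: dim_UNIV)
    then show "dim {v. n \<bullet> v = 0} \<le> dim (range ?F)"
      using dim_hyperplane[OF assms(3)] by simp
  qed (simp add: subspace_hyperplane)
  then show ?thesis using sub assms(4) by blast
qed

section \<open>Curvature of ruled surfaces\<close>

lemma partial_u_ruled: "partial_u (ruled \<gamma> \<beta>) t u = \<beta> t"
proof -
  have "((\<lambda>u. \<gamma> t + u *\<^sub>R \<beta> t) has_vector_derivative \<beta> t) (at u)"
    by (auto intro!: derivative_eq_intros)
  then show ?thesis
    unfolding partial_u_def ruled_def[abs_def] by (rule vector_derivative_at)
qed

lemma partial_t_ruled:
  assumes "at t within J \<noteq> bot"
    and "(\<gamma> has_vector_derivative \<gamma>') (at t within J)" "(\<beta> has_vector_derivative \<beta>') (at t within J)"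
  shows "partial_t J (ruled \<gamma> \<beta>) t u = \<gamma>' + u *\<^sub>R \<beta>'"
  unfolding partial_t_def ruled_def
  by (rule vector_derivative_within[OF assms(1)])
     (intro has_vector_derivative_add assms(2)
       bounded_linear.has_vector_derivative[OF bounded_linear_scaleR_right assms(3)])

lemma regular_at_ruled_iff:
  assumes "at t within J \<noteq> bot"
    and "(\<gamma> has_vector_derivative \<gamma>') (at t within J)" "(\<beta> has_vector_derivative \<beta>') (at t within J)"
  shows "regular_at J (ruled \<gamma> \<beta>) t u \<longleftrightarrow> cross3 (\<gamma>' + u *\<^sub>R \<beta>') (\<beta> t) \<noteq> 0"
  unfolding regular_at_def partial_u_ruled partial_t_ruled[OF assms] by (rule independent_iff_cross3)

text \<open>The rulings are straight, so \<open>r_uu = 0\<close> and the numerator of the curvature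
  is \<open>- M^2\<close>. In \<open>M\<close> the part \<open>u *\<^sub>R \<beta>'\<close> of
  \<open>r_t\<close> drops out of the triple product, where \<open>\<beta>'\<close> already
  occurs.\<close>

lemma gaussian_curvature_ruled_eq_0_iff:
  assumes "at t within J \<noteq> bot"
    and "(\<gamma> has_vector_derivative \<gamma>') (at t within J)" "(\<beta> has_vector_derivative \<beta>') (at t within J)"
    and "regular_at J (ruled \<gamma> \<beta>) t u"
  shows "gaussian_curvature J (ruled \<gamma> \<beta>) t u = 0 \<longleftrightarrow> \<beta>' \<bullet> cross3 \<gamma>' (\<beta> t) = 0"
proof -
  let ?rt = "\<gamma>' + u *\<^sub>R \<beta>'"
  let ?c = "cross3 ?rt (\<beta> t)"
  have c: "?c \<noteq> 0" using assms regular_at_ruled_iff by blast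
  have rt: "partial_t J (ruled \<gamma> \<beta>) t = (\<lambda>u. \<gamma>' + u *\<^sub>R \<beta>')"
    using partial_t_ruled[OF assms(1-3)] by blast
  have rtu: "partial_u (partial_t J (ruled \<gamma> \<beta>)) t u = \<beta>'"
    unfolding partial_u_def rt by (rule vector_derivative_at) (auto intro!: derivative_eq_intros)
  have "partial_u (ruled \<gamma> \<beta>) t = (\<lambda>u. \<beta> t)" using partial_u_ruled by blast
  then have ruu: "partial_u (partial_u (ruled \<gamma> \<beta>)) t u = 0"
    by (simp add: partial_u_def[of "partial_u (ruled \<gamma> \<beta>)"])
  \<comment> \<open>By Lagrange's identity the denominator \<open>E * G - F^2\<close> is the squared
    length of \<open>?c\<close>. It is nonzero, so a zero curvature is not merely the default value
    of division by zero.\<close>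
  have "(?rt \<bullet> ?rt) * (\<beta> t \<bullet> \<beta> t) - (?rt \<bullet> \<beta> t)\<^sup>2 = (norm ?c)\<^sup>2"
    using norm_cross_dot[of ?rt "\<beta> t"] by (simp add: power_mult_distrib power2_norm_eq_inner)
  moreover have "\<beta>' \<bullet> ?c = \<beta>' \<bullet> cross3 \<gamma>' (\<beta> t)"
    by (simp add: cross_add_left cross_mult_left inner_add_right dot_cross_self)
  ultimately show ?thesis
    using c by (simp add: gaussian_curvature_def Let_def surface_normal_def rtu ruu partial_u_ruled
        partial_t_ruled[OF assms(1-3)])
qed


section \<open>The developable surface tangent along a curve\<close>

text \<open>The difference \<open>z\<close> of the two sides lies in the span of \<open>e\<close>
  and \<open>h\<close> and is orthogonal to both, hence to itself.\<close>

lemma orthonormal_expansion: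
  assumes "norm e = 1" "norm n = 1" "e \<bullet> n = 0" "w \<bullet> n = 0"
  defines "h \<equiv> cross3 n e"
  shows "w = (w \<bullet> e) *\<^sub>R e + (w \<bullet> h) *\<^sub>R h"
proof -
  have ee: "e \<bullet> e = 1" and nn: "n \<bullet> n = 1" using assms by (auto simp: norm_eq_1)
  have "(norm h)\<^sup>2 = 1"
    using norm_cross_dot[of n e] assms by (simp add: inner_commute)
  then have hh: "h \<bullet> h = 1" by (simp add: power2_norm_eq_inner)
  have he: "h \<bullet> e = 0" "e \<bullet> h = 0" and hn: "h \<bullet> n = 0" "n \<bullet> h = 0"
    unfolding h_def by (simp_all add: dot_cross_self)
  \<comment> \<open>Cycling the triple product turns it into \<open>h \<bullet> cross3 n e\<close>,
    the squared length of \<open>h\<close>.\<close>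
  have "n \<bullet> cross3 e h = 1"
    using triple_product_cycle[of n e h] hh by (simp add: h_def)
  then have "cross3 e h \<noteq> 0" by force
  then have span: "span {e, h} = {v. n \<bullet> v = 0}"
    using assms hn by (intro span_eq_plane) (auto simp: inner_commute)
  define z where "z = w - ((w \<bullet> e) *\<^sub>R e + (w \<bullet> h) *\<^sub>R h)"
  have "z \<bullet> e = 0" "z \<bullet> h = 0" "n \<bullet> z = 0"
    unfolding z_def using ee hh he hn assms(3,4)
    by (simp_all add: inner_diff_left inner_add_left inner_diff_right inner_add_right inner_commute[of n])
  then have "z \<in> span {e, h}" "\<And>y. y \<in> {e, h} \<Longrightarrow> orthogonal z y"
    unfolding span by (auto simp: orthogonal_def)
  then have "orthogonal z z" by (metis orthogonal_to_span)
  then show ?thesis unfolding z_def by (simp add: orthogonal_self)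
qed

locale darboux_framed_curve =
  fixes S :: "(real^3) set" and \<alpha> :: real and J :: "real set"
    and \<gamma> N :: "real \<Rightarrow> real^3" and \<kappa>g \<kappa>n \<tau>g :: "real \<Rightarrow> real"
  assumes alpha_pos: "0 < \<alpha>" and J_def: "J = {0..\<alpha>}"
    and surface: "regular_surface S"
    and curve: "regular_curve_on S J \<gamma>"
    and normal: "unit_normal_along S J \<gamma> N"
    and curvatures: "darboux_curvatures J \<gamma> N \<kappa>g \<kappa>n \<tau>g"
    and kn_nz: "\<forall>t\<in>J. \<kappa>n t \<noteq> 0"
begin

abbreviation "\<gamma>' \<equiv> deriv_on J \<gamma>"
abbreviation "e \<equiv> darboux_e J \<gamma>"
abbreviation "h \<equiv> darboux_h J \<gamma> N"
abbreviation "v t \<equiv> norm (\<gamma>' t)"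
abbreviation "\<omega> \<equiv> omega_hat J \<gamma> N \<kappa>n \<tau>g"
abbreviation "b \<equiv> developable_ruling J \<gamma> N \<kappa>n \<tau>g"

section \<open>Smoothness and orthonormality of the Darboux frame\<close>

lemma nontrivial: "t \<in> J \<Longrightarrow> at t within J \<noteq> bot"
  using alpha_pos by (simp add: J_def trivial_limit_within)

lemma velocity_nz: "t \<in> J \<Longrightarrow> \<gamma>' t \<noteq> 0"
  using curve by (simp add: regular_curve_on_def)

lemma smooth_velocity: "smooth_on J \<gamma>'"
  and velocity: "t \<in> J \<Longrightarrow> (\<gamma> has_vector_derivative \<gamma>' t) (at t within J)"
  using curve smooth_onD[of J, OF nontrivial] by (auto simp: regular_curve_on_def)

lemma smooth_N: "smooth_on J N" and norm_N: "t \<in> J \<Longrightarrow> norm (N t) = 1"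
  using normal by (auto simp: unit_normal_along_def)

lemma smooth_e: "smooth_on J e"
  unfolding darboux_e_def[abs_def]
  by (intro smooth_on_normalize nontrivial smooth_velocity velocity_nz)

lemma smooth_h: "smooth_on J h"
  unfolding darboux_h_def[abs_def]
  by (intro smooth_on_bilinear[OF nontrivial bounded_bilinear_cross3] smooth_N smooth_e)

lemma norm_e: "t \<in> J \<Longrightarrow> norm (e t) = 1"
  using velocity_nz by (simp add: darboux_e_def)

lemma velocity_eq: "t \<in> J \<Longrightarrow> \<gamma>' t = v t *\<^sub>R e t"
  using velocity_nz by (simp add: darboux_e_def)

lemma h_orth: "h t \<bullet> N t = 0" "h t \<bullet> e t = 0" "N t \<bullet> h t = 0" "e t \<bullet> h t = 0"
  by (simp_all add: darboux_h_def dot_cross_self)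

lemma darboux_equations:
  assumes "t \<in> J"
  shows "deriv_on J e t = v t *\<^sub>R (\<kappa>g t *\<^sub>R h t + \<kappa>n t *\<^sub>R N t)"
    and "deriv_on J h t = v t *\<^sub>R (- \<kappa>g t *\<^sub>R e t + \<tau>g t *\<^sub>R N t)"
    and "deriv_on J N t = v t *\<^sub>R (- \<kappa>n t *\<^sub>R e t - \<tau>g t *\<^sub>R h t)"
  using curvatures assms by (simp_all add: darboux_curvatures_def Let_def)

text \<open>Tangency of \<open>e\<close> at the end points of \<open>J\<close> is not immediate from the definition of the tangent
  plane by curves on open intervals; here it comes from \<open>N \<bullet> N' = 0\<close> and \<open>\<kappa>n \<noteq> 0\<close>.\<close>

lemma e_orth_N:
  assumes "t \<in> J"
  shows "e t \<bullet> N t = 0"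
proof -
  note N' = smooth_onD(1)[OF nontrivial smooth_N assms]
  have "N t \<bullet> deriv_on J N t + deriv_on J N t \<bullet> N t = 0"
    by (rule inner_const_deriv[OF nontrivial N' N' _ assms]) (use norm_N in \<open>auto simp: norm_eq_1\<close>)
  then have "deriv_on J N t \<bullet> N t = 0" by (simp add: inner_commute)
  then show ?thesis
    using velocity_nz[OF assms] kn_nz assms darboux_equations(3)[OF assms] h_orth
    by (simp add: inner_diff_left)
qed

lemma frame_inner:
  assumes "t \<in> J"
  shows "e t \<bullet> e t = 1" "N t \<bullet> N t = 1" "h t \<bullet> h t = 1" "N t \<bullet> e t = 0"
proof -
  show ee: "e t \<bullet> e t = 1" and nn: "N t \<bullet> N t = 1" and "N t \<bullet> e t = 0"
    using norm_e norm_N e_orth_N assms by (auto simp: norm_eq_1 inner_commute)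
  have "(norm (h t))\<^sup>2 = 1"
    using norm_cross_dot[of "N t" "e t"] norm_e norm_N e_orth_N assms
    by (simp add: inner_commute darboux_h_def)
  then show "h t \<bullet> h t = 1" by (simp add: power2_norm_eq_inner)
qed

lemmas frame = frame_inner e_orth_N h_orth

lemma N_nz: "t \<in> J \<Longrightarrow> N t \<noteq> 0"
  using norm_N by fastforce

lemma velocity_orth_N: "t \<in> J \<Longrightarrow> N t \<bullet> \<gamma>' t = 0"
  using velocity_eq frame by (metis inner_scaleR_right mult_zero_right)

text \<open>The curvatures are given only as functions satisfying the Darboux equations, so their
  smoothness must be derived. On \<open>J\<close> this expression is \<open>\<kappa>n\<close> for
  \<open>f = e\<close> and \<open>\<tau>g\<close> for \<open>f = h\<close>.\<close>

lemma smooth_deriv_normal_component: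
  assumes "smooth_on J f"
  shows "smooth_on J (\<lambda>t. inverse (v t) *\<^sub>R (deriv_on J f t \<bullet> N t))"
proof -
  \<comment> \<open>This exhibits the speed as an inner product of smooth fields. It holds for all
    \<open>t\<close>, since \<open>e t\<close> is zero where \<open>\<gamma>' t\<close> is, and can
    therefore be used as a rewrite rule under the binder.\<close>
  have eq: "\<gamma>' t \<bullet> e t = v t" for t
    by (cases "\<gamma>' t = 0") (auto simp: darboux_e_def dot_square_norm power2_eq_square)
  have "smooth_on J (\<lambda>t. \<gamma>' t \<bullet> e t)"
    by (intro smooth_on_bilinear[OF nontrivial bounded_bilinear_inner] smooth_velocity smooth_e)
  then have v: "smooth_on J (\<lambda>t. inverse (v t))"
    unfolding eq smooth_on_def by (auto intro!: Ck_on_inverse[OF nontrivial] simp: velocity_nz)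
  show ?thesis
    by (intro smooth_on_bilinear[OF nontrivial bounded_bilinear_scaleR v]
        smooth_on_bilinear[OF nontrivial bounded_bilinear_inner]
        smooth_onD(2)[OF nontrivial] assms smooth_N)
qed

lemma curvature_eqs:
  assumes "t \<in> J"
  shows "inverse (v t) *\<^sub>R (deriv_on J e t \<bullet> N t) = \<kappa>n t"
    and "inverse (v t) *\<^sub>R (deriv_on J h t \<bullet> N t) = \<tau>g t"
  using velocity_nz[OF assms] frame(1-5)[OF assms] h_orth
  by (simp_all add: darboux_equations[OF assms] inner_add_left inner_diff_left)

section \<open>The field \<open>\<omega>\<close> and its normalization \<open>b\<close>\<close>

lemma norm_omega:
  assumes "t \<in> J"
  shows "norm (\<omega> t) = sqrt ((\<kappa>n t)\<^sup>2 + (\<tau>g t)\<^sup>2)"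
  unfolding norm_eq_sqrt_inner omega_hat_def
  using frame(1-5)[OF assms] h_orth
  by (simp add: inner_diff_left inner_diff_right power2_eq_square)

lemma omega_nz: "t \<in> J \<Longrightarrow> \<omega> t \<noteq> 0"
  using norm_omega kn_nz by (metis norm_zero real_sqrt_eq_zero_cancel_iff sum_power2_eq_zero_iff)

lemma smooth_omega: "smooth_on J \<omega>"
proof -
  let ?k = "\<lambda>t. inverse (v t) *\<^sub>R (deriv_on J e t \<bullet> N t)"
  let ?\<tau> = "\<lambda>t. inverse (v t) *\<^sub>R (deriv_on J h t \<bullet> N t)"
  have "Ck_on k J \<omega>" for k
  \<comment> \<open>The formula by normal components agrees with \<open>\<omega>\<close> only on
    \<open>J\<close>; elsewhere the curvature functions are unconstrained.\<close>
  proof (rule Ck_on_cong[OF nontrivial])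
    have "Ck_on k J (\<lambda>t. ?k t *\<^sub>R h t)" "Ck_on k J (\<lambda>t. ?\<tau> t *\<^sub>R e t)"
      using smooth_on_bilinear[OF nontrivial bounded_bilinear_scaleR smooth_deriv_normal_component[OF smooth_e] smooth_h]
        smooth_on_bilinear[OF nontrivial bounded_bilinear_scaleR smooth_deriv_normal_component[OF smooth_h] smooth_e]
      unfolding smooth_on_def by blast+
    then show "Ck_on k J (\<lambda>t. ?k t *\<^sub>R h t + (-1) *\<^sub>R (?\<tau> t *\<^sub>R e t))"
      by (intro Ck_on_add[OF nontrivial] Ck_on_scaleR_const[OF nontrivial])
    show "?k t *\<^sub>R h t + (-1) *\<^sub>R (?\<tau> t *\<^sub>R e t) = \<omega> t" if "t \<in> J" for t
      unfolding curvature_eqs[OF that] omega_hat_def by simp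
  qed
  then show ?thesis unfolding smooth_on_def by blast
qed

lemma smooth_b: "smooth_on J b"
  unfolding developable_ruling_def[abs_def]
  by (intro smooth_on_normalize nontrivial smooth_omega omega_nz)

lemma norm_b: "t \<in> J \<Longrightarrow> norm (b t) = 1"
  using omega_nz by (simp add: developable_ruling_def)

text \<open>Up to the factor \<open>- v t\<close>, the derivative of \<open>N\<close> is
  \<open>\<kappa>n e + \<tau>g h\<close>; a quarter turn of this vector in the tangent plane gives
  \<open>\<omega>\<close>.\<close>

lemma omega_orth:
  assumes "t \<in> J"
  shows "\<omega> t \<bullet> N t = 0" "\<omega> t \<bullet> deriv_on J N t = 0"
  using frame(1-5)[OF assms] h_orth
  by (simp_all add: omega_hat_def darboux_equations(3)[OF assms] inner_diff_left inner_diff_right)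

text \<open>Differentiating \<open>\<beta> \<bullet> N = 0\<close> moves the derivative from
  \<open>\<beta>\<close> to \<open>N\<close>, which leaves a pointwise linear condition on
  \<open>\<beta>\<close>.\<close>

lemma deriv_orth_N_iff:
  assumes "smooth_on J \<beta>" "\<And>t. t \<in> J \<Longrightarrow> \<beta> t \<bullet> N t = 0" "t \<in> J"
  shows "N t \<bullet> deriv_on J \<beta> t = 0 \<longleftrightarrow> \<beta> t \<bullet> deriv_on J N t = 0"
  using inner_const_deriv[OF nontrivial smooth_onD(1)[OF nontrivial assms(1,3)]
      smooth_onD(1)[OF nontrivial smooth_N assms(3)] assms(2,3)]
  by (auto simp: inner_commute)

lemma tangent_plane_N: "t \<in> J \<Longrightarrow> tangent_plane S (\<gamma> t) = {w. N t \<bullet> w = 0}"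
  using surface curve normal N_nz
  by (intro tangent_plane_eq_hyperplane)
     (auto simp: regular_curve_on_def unit_normal_along_def orthogonal_def)

text \<open>Crossing with \<open>\<gamma>'\<close> removes the \<open>e\<close> part of
  \<open>\<omega>\<close> and leaves the \<open>h\<close> part, whose coefficient is
  \<open>\<kappa>n\<close>.\<close>

lemma b_transversal: "t \<in> J \<Longrightarrow> cross3 (\<gamma>' t) (b t) \<noteq> 0"
proof -
  assume t: "t \<in> J"
  have "N t \<bullet> cross3 (e t) (h t) = 1"
    using triple_product_cycle[of "N t" "e t" "h t"] frame(3)[OF t] by (simp add: darboux_h_def)
  moreover have "cross3 (\<gamma>' t) (b t) = (v t / norm (\<omega> t) * \<kappa>n t) *\<^sub>R cross3 (e t) (h t)"
    unfolding developable_ruling_def omega_hat_def[of _ _ _ _ _ t]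
    by (subst velocity_eq[OF t])
       (simp add: cross_mult_left cross_mult_right Cross3.right_diff_distrib divide_inverse)
  ultimately show ?thesis
    using omega_nz[OF t] velocity_nz[OF t] kn_nz t by force
qed

text \<open>The resulting condition does not contain \<open>u\<close>: flatness at one regular point
  of a ruling is flatness at all of them.\<close>

lemma gaussian_curvature_eq_0_iff:
  assumes "smooth_on J \<beta>" "\<And>t. t \<in> J \<Longrightarrow> \<beta> t \<bullet> N t = 0" "t \<in> J"
    and "regular_at J (ruled \<gamma> \<beta>) t u" "cross3 (\<gamma>' t) (\<beta> t) \<noteq> 0"
  shows "gaussian_curvature J (ruled \<gamma> \<beta>) t u = 0 \<longleftrightarrow> \<beta> t \<bullet> deriv_on J N t = 0"
proof -
  note \<beta>' = smooth_onD(1)[OF nontrivial assms(1,3)]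
  have "gaussian_curvature J (ruled \<gamma> \<beta>) t u = 0 \<longleftrightarrow> deriv_on J \<beta> t \<bullet> cross3 (\<gamma>' t) (\<beta> t) = 0"
    by (rule gaussian_curvature_ruled_eq_0_iff[OF nontrivial[OF assms(3)] velocity[OF assms(3)] \<beta>' assms(4)])
  also have "\<dots> \<longleftrightarrow> N t \<bullet> deriv_on J \<beta> t = 0"
    using assms by (intro inner_cross3_eq_0_iff N_nz velocity_orth_N) (auto simp: inner_commute)
  also have "\<dots> \<longleftrightarrow> \<beta> t \<bullet> deriv_on J N t = 0" by (rule deriv_orth_N_iff[OF assms(1-3)])
  finally show ?thesis .
qed

section \<open>Regularity, flatness and tangency of the surface ruled by \<open>b\<close>\<close>

lemma b_orth:
  assumes "t \<in> J"
  shows "b t \<bullet> N t = 0" "b t \<bullet> deriv_on J N t = 0"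
  using omega_orth[OF assms] by (simp_all add: developable_ruling_def)

text \<open>The cross product of the partial derivatives is \<open>?A t + u *\<^sub>R ?B t\<close>.
  On the compact \<open>J\<close> the norm of \<open>?A\<close> has a positive minimum and that of
  \<open>?B\<close> is bounded, so \<open>?A\<close> dominates for small \<open>u\<close>.\<close>

lemma b_regular:
  "\<exists>\<delta>>0. \<forall>wm wp. (\<forall>t\<in>J. wm t \<in> {0<..\<delta>} \<and> wp t \<in> {0<..\<delta>}) \<longrightarrow> regular_ruled_surface J \<gamma> b wm wp"
proof -
  let ?A = "\<lambda>t. cross3 (\<gamma>' t) (b t)" and ?B = "\<lambda>t. cross3 (deriv_on J b t) (b t)"
  have J: "compact J" "J \<noteq> {}" using alpha_pos by (auto simp: J_def)
  have sm: "smooth_on J ?A" "smooth_on J ?B"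
    by (intro smooth_on_bilinear[OF nontrivial bounded_bilinear_cross3] smooth_velocity smooth_b
        smooth_onD(2)[OF nontrivial]; assumption)+
  then have contA: "continuous_on J (\<lambda>t. norm (?A t))" and contB: "continuous_on J (\<lambda>t. norm (?B t))"
    by (auto intro: continuous_on_norm smooth_on_imp_continuous_on)
  obtain s where s: "s \<in> J" "\<And>t. t \<in> J \<Longrightarrow> norm (?A s) \<le> norm (?A t)"
    using continuous_attains_inf[OF J contA] by blast
  obtain r where r: "r \<in> J" "\<And>t. t \<in> J \<Longrightarrow> norm (?B t) \<le> norm (?B r)"
    using continuous_attains_sup[OF J contB] by blast
  \<comment> \<open>The summand 1 covers the case \<open>M = 0\<close> and makes
    \<open>\<delta> * M < m\<close> strict.\<close>
  define m M \<delta> where "m = norm (?A s)" and "M = norm (?B r)" and "\<delta> = m / (M + 1)"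
  have m: "m > 0" using b_transversal[OF s(1)] by (simp add: m_def)
  have M: "M \<ge> 0" by (simp add: M_def)
  have \<delta>: "\<delta> > 0" using m M by (simp add: \<delta>_def)
  have "\<delta> * M + \<delta> = m" using M by (simp add: \<delta>_def field_simps add_nonneg_eq_0_iff)
  then have \<delta>M: "\<delta> * M < m" using \<delta> by simp
  have reg: "regular_at J (ruled \<gamma> b) t u" if "t \<in> J" "\<bar>u\<bar> \<le> \<delta>" for t u
  proof -
    have "norm (u *\<^sub>R ?B t) \<le> \<delta> * M"
      using r(2)[OF that(1)] that(2) \<delta> unfolding M_def norm_scaleR by (intro mult_mono) auto
    also have "\<dots> < norm (?A t)" using s(2)[OF that(1)] \<delta>M by (simp add: m_def)
    finally have "?A t + u *\<^sub>R ?B t \<noteq> 0"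
      by (metis add_eq_0_iff less_irrefl norm_minus_cancel)
    then show ?thesis
      using that by (simp add: regular_at_ruled_iff[OF nontrivial velocity smooth_onD(1)[OF nontrivial smooth_b]]
          cross_add_left cross_mult_left)
  qed
  have "regular_ruled_surface J \<gamma> b wm wp" if w: "\<forall>t\<in>J. wm t \<in> {0<..\<delta>} \<and> wp t \<in> {0<..\<delta>}" for wm wp
    unfolding regular_ruled_surface_def
  proof (intro conjI ballI)
    show "regular_at J (ruled \<gamma> b) t u" if "t \<in> J" "u \<in> {- wm t..wp t}" for t u
      using w that by (intro reg) fastforce+
  qed (use w in \<open>auto simp: smooth_b norm_b\<close>)
  then show ?thesis using \<delta> by blast
qed

lemma b_developable:
  assumes "regular_ruled_surface J \<gamma> b wm wp"
  shows "developable_surface J \<gamma> b wm wp"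
  using assms gaussian_curvature_eq_0_iff[OF smooth_b b_orth(1)] b_orth(2) b_transversal
  unfolding developable_surface_def regular_ruled_surface_def by blast

lemma b_same_tangent_plane: "same_tangent_plane_along S J \<gamma> b"
  unfolding same_tangent_plane_along_def
proof
  fix t assume t: "t \<in> J"
  have "span {\<gamma>' t, b t} = {w. N t \<bullet> w = 0}"
    using b_orth(1)[OF t]
    by (intro span_eq_plane b_transversal N_nz velocity_orth_N t) (simp add: inner_commute)
  then show "span {partial_t J (ruled \<gamma> b) t 0, partial_u (ruled \<gamma> b) t 0} = tangent_plane S (\<gamma> t)"
    using t by (simp add: partial_u_ruled tangent_plane_N
        partial_t_ruled[OF nontrivial velocity smooth_onD(1)[OF nontrivial smooth_b]])
qed

text \<open>Pointwise \<open>\<beta>\<close> is \<open>\<plusminus>b\<close>; the sign \<open>\<beta> \<bullet> b\<close> is continuous, hence constant on the connected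
  set \<open>J\<close>.\<close>

lemma developable_unique:
  assumes dev: "developable_surface J \<gamma> \<beta> wm wp" and tan: "same_tangent_plane_along S J \<gamma> \<beta>"
  shows "\<exists>\<sigma>\<in>{1, -1::real}. \<forall>t\<in>J. \<beta> t = \<sigma> *\<^sub>R b t"
proof -
  have sm: "smooth_on J \<beta>" and nm: "\<And>t. t \<in> J \<Longrightarrow> norm (\<beta> t) = 1"
    and w: "\<And>t. t \<in> J \<Longrightarrow> 0 \<in> {- wm t..wp t}"
    using dev unfolding developable_surface_def regular_ruled_surface_def by force+
  \<comment> \<open>Only the points with \<open>u = 0\<close> are used; they lie on the surface
    because both widths are positive.\<close>
  then have reg: "regular_at J (ruled \<gamma> \<beta>) t 0" and K: "gaussian_curvature J (ruled \<gamma> \<beta>) t 0 = 0"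
    if "t \<in> J" for t
    using dev that unfolding developable_surface_def regular_ruled_surface_def by blast+
  have orth: "\<beta> t \<bullet> N t = 0" if "t \<in> J" for t
  proof -
    have "\<beta> t \<in> tangent_plane S (\<gamma> t)"
      using tan that unfolding same_tangent_plane_along_def partial_u_ruled
      by (metis insertI1 insertI2 span_base)
    then show ?thesis using that by (simp add: tangent_plane_N inner_commute)
  qed
  have cross: "cross3 (\<gamma>' t) (\<beta> t) \<noteq> 0" if "t \<in> J" for t
    using reg[OF that] that
    by (simp add: regular_at_ruled_iff[OF nontrivial velocity smooth_onD(1)[OF nontrivial sm]])
  have pm: "\<beta> t = (\<beta> t \<bullet> b t) *\<^sub>R b t \<and> \<beta> t \<bullet> b t \<in> {1, -1}" if t: "t \<in> J" for t
  proof -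
    have "\<beta> t \<bullet> deriv_on J N t = 0"
      using gaussian_curvature_eq_0_iff[OF sm orth t reg[OF t] cross[OF t]] K[OF t] by simp
    \<comment> \<open>By the third Darboux equation, orthogonality to the derivative of
      \<open>N\<close> is one linear relation between the tangential coordinates of
      \<open>\<beta>\<close>. As \<open>\<kappa>n\<close> is nonzero, the \<open>h\<close>
      coordinate determines the \<open>e\<close> coordinate.\<close>
    then have eq: "\<kappa>n t * (\<beta> t \<bullet> e t) = - \<tau>g t * (\<beta> t \<bullet> h t)"
      using velocity_nz[OF t] by (simp add: darboux_equations(3)[OF t] inner_diff_right)
    have k: "\<kappa>n t \<noteq> 0" using kn_nz t by blast
    \<comment> \<open>The factor \<open>norm (\<omega> t)\<close> undoes the normalization of
      \<open>b\<close>.\<close>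
    define c where "c = (\<beta> t \<bullet> h t) / \<kappa>n t * norm (\<omega> t)"
    have be: "\<beta> t \<bullet> e t = - \<tau>g t * (\<beta> t \<bullet> h t) / \<kappa>n t" using eq k by (simp add: field_simps)
    have "\<beta> t = (\<beta> t \<bullet> e t) *\<^sub>R e t + (\<beta> t \<bullet> h t) *\<^sub>R h t"
      using orthonormal_expansion[OF norm_e norm_N e_orth_N orth] t by (simp add: darboux_h_def)
    also have "\<dots> = ((\<beta> t \<bullet> h t) / \<kappa>n t) *\<^sub>R \<omega> t"
      unfolding be using k by (simp add: omega_hat_def scaleR_diff_right)
    also have "\<dots> = c *\<^sub>R b t"
      using omega_nz[OF t] by (simp add: c_def developable_ruling_def)
    finally have c: "\<beta> t = c *\<^sub>R b t" .
    have "\<bar>c\<bar> = 1" using nm[OF t] norm_b[OF t] unfolding c by simp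
    moreover have "\<beta> t \<bullet> b t = c" using norm_b[OF t] unfolding c by (simp add: norm_eq_1)
    ultimately show ?thesis using c by (auto simp: abs_if split: if_splits)
  qed
  have "continuous_on J (\<lambda>t. \<beta> t \<bullet> b t)"
    by (intro continuous_on_inner smooth_on_imp_continuous_on sm smooth_b)
  moreover have "(\<lambda>t. \<beta> t \<bullet> b t) ` J \<subseteq> {1, -1}" using pm by blast
  then have "finite ((\<lambda>t. \<beta> t \<bullet> b t) ` J)" by (rule finite_subset) simp
  moreover have "connected J" by (simp add: J_def)
  ultimately have "(\<lambda>t. \<beta> t \<bullet> b t) constant_on J"
    using continuous_finite_range_constant by blast
  then obtain \<sigma> where \<sigma>: "\<And>t. t \<in> J \<Longrightarrow> \<beta> t \<bullet> b t = \<sigma>" unfolding constant_on_def by blast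
  have "0 \<in> J" using alpha_pos by (simp add: J_def)
  then have "\<sigma> \<in> {1, -1}" using pm \<sigma> by force
  moreover have "\<forall>t\<in>J. \<beta> t = \<sigma> *\<^sub>R b t" using pm \<sigma> by metis
  ultimately show ?thesis by blast
qed

end

text \<open>Regular widths exist by the uniform bound \<open>\<delta>\<close>; flatness and tangency
  then hold for every regular choice of widths. Uniqueness compares ruling fields only, with one
  sign for the whole of \<open>J\<close>.\<close>

theorem theorem3p1:
  fixes S :: "(real^3) set" and \<alpha> :: real and J :: "real set"
    and \<gamma> N :: "real \<Rightarrow> real^3" and \<kappa>g \<kappa>n \<tau>g :: "real \<Rightarrow> real"
  assumes "0 < \<alpha>" and "J = {0..\<alpha>}"
    and "regular_surface S"
    and "regular_curve_on S J \<gamma>"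
    and "unit_normal_along S J \<gamma> N"
    and "darboux_curvatures J \<gamma> N \<kappa>g \<kappa>n \<tau>g"
    and "\<forall>t\<in>J. \<kappa>n t \<noteq> 0"
  shows
    "(\<forall>t\<in>J. norm (omega_hat J \<gamma> N \<kappa>n \<tau>g t) = sqrt ((\<kappa>n t)\<^sup>2 + (\<tau>g t)\<^sup>2)) \<and>
     (\<exists>\<delta>>0. \<forall>wm wp. (\<forall>t\<in>J. wm t \<in> {0<..\<delta>} \<and> wp t \<in> {0<..\<delta>}) \<longrightarrow>
        regular_ruled_surface J \<gamma> (developable_ruling J \<gamma> N \<kappa>n \<tau>g) wm wp) \<and>
     (\<forall>wm wp. regular_ruled_surface J \<gamma> (developable_ruling J \<gamma> N \<kappa>n \<tau>g) wm wp \<longrightarrow>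
        developable_surface J \<gamma> (developable_ruling J \<gamma> N \<kappa>n \<tau>g) wm wp \<and>
        same_tangent_plane_along S J \<gamma> (developable_ruling J \<gamma> N \<kappa>n \<tau>g)) \<and>
     (\<forall>\<beta> wm wp. developable_surface J \<gamma> \<beta> wm wp \<and> same_tangent_plane_along S J \<gamma> \<beta> \<longrightarrow>
        (\<exists>\<sigma>\<in>{1, -1::real}. \<forall>t\<in>J. \<beta> t = \<sigma> *\<^sub>R developable_ruling J \<gamma> N \<kappa>n \<tau>g t))"
proof -
  interpret darboux_framed_curve S \<alpha> J \<gamma> N \<kappa>g \<kappa>n \<tau>g
    using assms by unfold_locales
  show ?thesis
    using norm_omega b_regular b_developable b_same_tangent_plane developable_unique by blast
qed

end
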